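(* For $m\ge 3$, the Sperner systems $\mathcal{M}^m_1$ and $\mathcal{M}^m_2$ are nonisomorphic and strongly hypomorphic with respect to the reconstruction problem for hypergraphs and vertex-deleted subhypergraphs.
   Context: A set system over a finite set $A$ is a set of subsets of $A$, called blocks; it is a Sperner system if no block is included in another. A set system is regarded as a hypergraph with vertex set $A$ and edge set the set of blocks. Hypergraphs $G$, $H$ are isomorphic, $G\equiv H$, if there is a bijection between their vertex sets mapping the edge set of $G$ onto the edge set of $H$. For a hypergraph $G$ and vertex $v\in V(G)$, $G-v$ is the hypergraph with vertex set $V(G)\setminus\{v\}$ and edge set $\{e\in E(G):v\notin e\}$. Two hypergraphs $G,H$ on the same vertex set $V$ are strongly hypomorphic with respect to the reconstruction problem for hypergraphs and vertex-deleted subhypergraphs if $G-v\equiv H-v$ for every $v\in V$. Let $[m]=\{1,\dots,m\}$. For each $n\in[m]$ let $n'$ be a new element (a primed copy of $n$), and $S'=\{n':n\in S\}$ for $S\subseteq[m]$. Let $E_m=[m]\cup[m]'$, a set with $2m$ elements. Addition of elements of $[m]$ is modulo $m$ with result taken in $[m]$. For $J\subseteq[m]$ let $F^m_J=J\cup([m]\setminus J)'$. Put $\mathcal F^m_1=\{F^m_J: J\subseteq[m],\ |J|\text{ odd}\}$ and $\mathcal F^m_2=\{F^m_J: J\subseteq[m],\ |J|\text{ even}\}$. For $p\in[m]$ let $G^m_p=E_m\setminus\{p,p',(p+1)'\}$ and $\mathcal G^m=\{G^m_p:p\in[m]\}$. For $i\in\{1,2\}$, $\mathcal M^m_i=\mathcal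 F^m_i\cup\mathcal G^m$, a Sperner system over $E_m$. *)

theory Defs
  imports Main
begin

text \<open>A hypergraph is a pair of a vertex set and an edge set. The pair itself is unconstrained;
  well-formedness of the edges is the predicate \<open>set_system\<close>.\<close>

type_synonym 'a hypergraph = "'a set \<times> 'a set set"

abbreviation verts :: "'a hypergraph \<Rightarrow> 'a set" where
  "verts \<equiv> fst"

abbreviation edges :: "'a hypergraph \<Rightarrow> 'a set set" where
  "edges \<equiv> snd"

definition set_system :: "'a set \<Rightarrow> 'a set set \<Rightarrow> bool" where
  "set_system A B \<longleftrightarrow> finite A \<and> B \<subseteq> Pow A"

definition sperner_system :: "'a set \<Rightarrow> 'a set set \<Rightarrow> bool" where
  "sperner_system A B \<longleftrightarrow> set_system A B \<and> (\<forall>b\<in>B. \<forall>c\<in>B. b \<subseteq> c \<longrightarrow> b = c)"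

definition hypergraph_iso :: "'a hypergraph \<Rightarrow> 'b hypergraph \<Rightarrow> bool" (infix "\<cong>\<^sub>h" 50) where
  "G \<cong>\<^sub>h H \<longleftrightarrow> (\<exists>f. bij_betw f (verts G) (verts H) \<and> (\<lambda>e. f ` e) ` edges G = edges H)"

definition delete_vertex :: "'a hypergraph \<Rightarrow> 'a \<Rightarrow> 'a hypergraph" where
  "delete_vertex G v = (verts G - {v}, {e \<in> edges G. v \<notin> e})"

definition strongly_hypomorphic :: "'a hypergraph \<Rightarrow> 'a hypergraph \<Rightarrow> bool" where
  "strongly_hypomorphic G H \<longleftrightarrow>
     verts G = verts H \<and> (\<forall>v\<in>verts G. delete_vertex G v \<cong>\<^sub>h delete_vertex H v)"

text \<open>The element \<open>n\<close> of \<open>[m]\<close> is \<open>Inl n\<close> and its primed copy \<open>n'\<close> is \<open>Inr n\<close>.\<close>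

definition E_set :: "nat \<Rightarrow> (nat + nat) set" where
  "E_set m = Inl ` {1..m} \<union> Inr ` {1..m}"

text \<open>Addition modulo \<open>m\<close> with representatives in \<open>{1..m}\<close> rather than \<open>{0..<m}\<close>.\<close>

definition cyc_add :: "nat \<Rightarrow> nat \<Rightarrow> nat \<Rightarrow> nat" where
  "cyc_add m a b = (if (a + b) mod m = 0 then m else (a + b) mod m)"

definition F_block :: "nat \<Rightarrow> nat set \<Rightarrow> (nat + nat) set" where
  "F_block m J = Inl ` J \<union> Inr ` ({1..m} - J)"

definition F1 :: "nat \<Rightarrow> (nat + nat) set set" where
  "F1 m = {F_block m J | J. J \<subseteq> {1..m} \<and> odd (card J)}"

definition F2 :: "nat \<Rightarrow> (nat + nat) set set" where
  "F2 m = {F_block m J | J. J \<subseteq> {1..m} \<and> even (card J)}"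

definition G_block :: "nat \<Rightarrow> nat \<Rightarrow> (nat + nat) set" where
  "G_block m p = E_set m - {Inl p, Inr p, Inr (cyc_add m p 1)}"

definition G_sys :: "nat \<Rightarrow> (nat + nat) set set" where
  "G_sys m = {G_block m p | p. p \<in> {1..m}}"

definition M1 :: "nat \<Rightarrow> (nat + nat) set set" where
  "M1 m = F1 m \<union> G_sys m"

definition M2 :: "nat \<Rightarrow> (nat + nat) set set" where
  "M2 m = F2 m \<union> G_sys m"

end

theory Submission
  imports Defs "HOL-Combinatorics.Transposition"
begin

text \<open>The transposition of \<open>b\<close> and \<open>b'\<close> exchanges \<open>\<F>\<^sub>1\<close> and \<open>\<F>\<^sub>2\<close>, and it fixes every
  \<open>G\<^sub>p\<close> except the one with \<open>p + 1 = b\<close>. If \<open>b = q - 1\<close>, that block contains both \<open>q\<close> and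
  \<open>q'\<close>, so the transposition is an isomorphism after deleting either of these vertices. On the
  other hand, the blocks \<open>F\<^sub>J\<close> avoiding a vertex are equally many for all vertices and both
  parities, while \<open>n\<close> is avoided by one block \<open>G\<^sub>p\<close> and \<open>n'\<close> by two. Hence an isomorphism
  preserves the set of primed vertices, which is a block of \<open>\<M>\<^sub>2\<close> but not of \<open>\<M>\<^sub>1\<close>.\<close>

text \<open>The parity is a Boolean argument, so one lemma covers both systems and exchanging them
  is negation.\<close>

definition F_sys :: "nat \<Rightarrow> bool \<Rightarrow> (nat + nat) set set" where
  "F_sys m k = {F_block m J | J. J \<subseteq> {1..m} \<and> even (card J) = k}"

definition M_sys :: "nat \<Rightarrow> bool \<Rightarrow> (nat + nat) set set" where
  "M_sys m k = F_sys m k \<union> G_sys m"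

lemma M1_eq_M_sys: "M1 m = M_sys m False"
  by (simp add: M1_def M_sys_def F1_def F_sys_def)

lemma M2_eq_M_sys: "M2 m = M_sys m True"
  by (simp add: M2_def M_sys_def F2_def F_sys_def)

abbreviation flip :: "nat \<Rightarrow> nat + nat \<Rightarrow> nat + nat" where
  "flip b \<equiv> transpose (Inl b) (Inr b)"

lemma image_flip_image_flip: "flip b ` flip b ` e = e"
  by (simp add: image_image)

lemma mem_image_flip_iff: "flip b v \<in> flip b ` e \<longleftrightarrow> v \<in> e"
  by (rule inj_image_mem_iff) simp

section \<open>Membership in blocks and the cyclic successor\<close>

lemma E_set_mem [simp]: "Inl i \<in> E_set m \<longleftrightarrow> i \<in> {1..m}" "Inr i \<in> E_set m \<longleftrightarrow> i \<in> {1..m}"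
  by (auto simp: E_set_def)

lemma finite_E_set: "finite (E_set m)"
  by (simp add: E_set_def)

lemma F_block_mem [simp]:
  "Inl i \<in> F_block m J \<longleftrightarrow> i \<in> J" "Inr i \<in> F_block m J \<longleftrightarrow> i \<in> {1..m} \<and> i \<notin> J"
  by (auto simp: F_block_def)

lemma G_block_mem [simp]:
  "Inl i \<in> G_block m p \<longleftrightarrow> i \<in> {1..m} \<and> i \<noteq> p"
  "Inr i \<in> G_block m p \<longleftrightarrow> i \<in> {1..m} \<and> i \<noteq> p \<and> i \<noteq> cyc_add m p 1"
  by (auto simp: G_block_def)

lemma cyc_add_1:
  assumes "p \<in> {1..m}" "m \<ge> 2"
  shows "cyc_add m p (Suc 0) = (if p = m then 1 else p + 1)"
proof (cases "p + 1 < m")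
  case False
  then have "p + 1 = m \<or> p = m" using assms by auto
  then show ?thesis using assms by (auto simp: cyc_add_def mod_Suc)
qed (use assms in \<open>auto simp: cyc_add_def\<close>)

lemma cyc_predecessor:
  assumes "q \<in> {1..m}" "m \<ge> 2"
  obtains b where "b \<in> {1..m}" "cyc_add m b 1 = q"
proof (rule that[of "if q = 1 then m else q - 1"])
  show "(if q = 1 then m else q - 1) \<in> {1..m}" using assms by auto
  then show "cyc_add m (if q = 1 then m else q - 1) 1 = q" using assms by (auto simp: cyc_add_1)
qed

section \<open>The Sperner property\<close>

lemma F_sys_subset:
  assumes "e \<in> F_sys m k"
  shows "e \<subseteq> E_set m"
  using assms by (auto simp: F_sys_def F_block_def E_set_def)

lemma G_sys_subset:
  assumes "e \<in> G_sys m"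
  shows "e \<subseteq> E_set m"
  using assms by (auto simp: G_sys_def G_block_def)

lemma M_sys_subset: "M_sys m k \<subseteq> Pow (E_set m)"
  using F_sys_subset G_sys_subset unfolding M_sys_def by blast

lemma finite_M_sys: "finite (M_sys m k)"
  using M_sys_subset finite_E_set by (metis finite_Pow_iff finite_subset)

lemma F_sys_Inr_mem_iff:
  assumes "e \<in> F_sys m k" "i \<in> {1..m}"
  shows "Inr i \<in> e \<longleftrightarrow> Inl i \<notin> e"
  using assms by (auto simp: F_sys_def)

text \<open>The cyclic predecessor of \<open>p\<close> serves as \<open>i\<close>: for m \<ge> 3 it
  differs from both \<open>p\<close> and its successor, whereas for m = 2 predecessor and successor
  coincide. Such a pair keeps a block of \<open>G_sys\<close> from lying inside one of
  \<open>F_sys\<close>.\<close>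

lemma G_block_contains_pair:
  assumes "p \<in> {1..m}" "m \<ge> 3"
  obtains i where "i \<in> {1..m}" "Inl i \<in> G_block m p" "Inr i \<in> G_block m p"
proof -
  obtain b where b: "b \<in> {1..m}" "cyc_add m b 1 = p"
    using cyc_predecessor[of p m] assms by auto
  have "b \<noteq> p" "b \<noteq> cyc_add m p 1"
    using b assms by (auto simp: cyc_add_1 split: if_splits)
  with b(1) show ?thesis by (intro that[of b]) auto
qed

text \<open>Both blocks contain exactly one element of each pair \<open>Inl i\<close>,
  \<open>Inr i\<close>, so an inclusion forces the same choice in every pair.\<close>

lemma F_sys_subset_F_sys:
  assumes e: "e \<in> F_sys m k" and e': "e' \<in> F_sys m k'" and "e \<subseteq> e'"
  shows "e = e'"
proof
  show "e' \<subseteq> e"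
  proof
    fix v assume v: "v \<in> e'"
    then obtain i where i: "i \<in> {1..m}" "v = Inl i \<or> v = Inr i"
      using F_sys_subset[OF e'] by (auto simp: E_set_def)
    show "v \<in> e"
      using i(2) v \<open>e \<subseteq> e'\<close> F_sys_Inr_mem_iff[OF e i(1)] F_sys_Inr_mem_iff[OF e' i(1)] by blast
  qed
qed fact

text \<open>\<open>G_block m p\<close> misses both copies of \<open>p\<close>, while every block of
  \<open>F_sys\<close> contains one of them.\<close>

lemma not_F_sys_subset_G_sys:
  assumes "e \<in> F_sys m k" "e' \<in> G_sys m"
  shows "\<not> e \<subseteq> e'"
proof -
  obtain p where p: "p \<in> {1..m}" "e' = G_block m p"
    using assms(2) by (auto simp: G_sys_def)
  then have "Inl p \<notin> e'" "Inr p \<notin> e'" by auto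
  then show ?thesis using F_sys_Inr_mem_iff[OF assms(1) p(1)] by blast
qed

lemma not_G_sys_subset_F_sys:
  assumes "m \<ge> 3" "e \<in> F_sys m k" "e' \<in> G_sys m"
  shows "\<not> e' \<subseteq> e"
proof -
  obtain p where p: "p \<in> {1..m}" "e' = G_block m p"
    using assms by (auto simp: G_sys_def)
  obtain i where "i \<in> {1..m}" "Inl i \<in> e'" "Inr i \<in> e'"
    using G_block_contains_pair p assms(1) by metis
  then show ?thesis using F_sys_Inr_mem_iff[OF assms(2)] by blast
qed

text \<open>The only unprimed vertex missing from \<open>G_block m p\<close> is
  \<open>Inl p\<close>.\<close>

lemma G_block_subset_iff:
  assumes "p \<in> {1..m}" "q \<in> {1..m}"
  shows "G_block m p \<subseteq> G_block m q \<longleftrightarrow> p = q"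
  using assms G_block_mem(1)[of q m p] G_block_mem(1)[of q m q] by blast

lemma sperner_M_sys:
  assumes "m \<ge> 3"
  shows "sperner_system (E_set m) (M_sys m k)"
  unfolding sperner_system_def set_system_def
proof (intro conjI ballI impI)
  fix e e' assume *: "e \<in> M_sys m k" "e' \<in> M_sys m k" "e \<subseteq> e'"
  have "e = e'" if "e \<in> G_sys m" "e' \<in> G_sys m"
    using that *(3) by (auto simp: G_sys_def G_block_subset_iff)
  moreover have "e = e'" if "e \<in> F_sys m k" "e' \<in> F_sys m k"
    using F_sys_subset_F_sys[OF that *(3)] .
  ultimately show "e = e'"
    using * not_F_sys_subset_G_sys[of e m k e'] not_G_sys_subset_F_sys[OF assms, of e' k e]
    unfolding M_sys_def by blast
qed (simp_all add: finite_E_set M_sys_subset)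

section \<open>Transpositions and strong hypomorphy\<close>

lemma image_flip_F_block:
  assumes "b \<in> {1..m}"
  shows "flip b ` F_block m J = F_block m (if b \<in> J then J - {b} else insert b J)"
proof (intro set_eqI)
  fix v
  have "v \<in> flip b ` F_block m J \<longleftrightarrow> flip b v \<in> F_block m J"
    by (metis mem_image_flip_iff transpose_involutory)
  then show "v \<in> flip b ` F_block m J \<longleftrightarrow>
      v \<in> F_block m (if b \<in> J then J - {b} else insert b J)"
    using assms by (cases v) (auto simp: transpose_def)
qed

text \<open>Toggling \<open>b\<close> in \<open>J\<close> changes the size of \<open>J\<close> by
  one.\<close>

lemma image_flip_F_sys_mem:
  assumes "b \<in> {1..m}" "e \<in> F_sys m k"
  shows "flip b ` e \<in> F_sys m (\<not> k)"
proof -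
  obtain J where J: "e = F_block m J" "J \<subseteq> {1..m}" "even (card J) = k"
    using assms(2) by (auto simp: F_sys_def)
  let ?J = "if b \<in> J then J - {b} else insert b J"
  have "finite J" using J(2) finite_subset by blast
  then have "even (card ?J) = (\<not> k)"
    using J(3) card_Suc_Diff1[of J b] by auto
  moreover have "?J \<subseteq> {1..m}" using J(2) assms(1) by auto
  ultimately show ?thesis
    unfolding F_sys_def J(1) image_flip_F_block[OF assms(1)] by blast
qed

lemma image_flip_F_sys_avoiding:
  assumes "b \<in> {1..m}"
  shows "(\<lambda>e. flip b ` e) ` {e \<in> F_sys m k. v \<notin> e} = {e \<in> F_sys m (\<not> k). flip b v \<notin> e}"
proof
  show "(\<lambda>e. flip b ` e) ` {e \<in> F_sys m k. v \<notin> e} \<subseteq> {e \<in> F_sys m (\<not> k). flip b v \<notin> e}"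
    using image_flip_F_sys_mem[OF assms] by (intro image_subsetI) (simp add: mem_image_flip_iff)
  show "{e \<in> F_sys m (\<not> k). flip b v \<notin> e} \<subseteq> (\<lambda>e. flip b ` e) ` {e \<in> F_sys m k. v \<notin> e}"
  proof
    \<comment> \<open>The flip is an involution, so the preimage of \<open>e\<close> is its own
      flipped image.\<close>
    fix e assume e: "e \<in> {e \<in> F_sys m (\<not> k). flip b v \<notin> e}"
    then have "flip b ` e \<in> F_sys m k"
      using image_flip_F_sys_mem[OF assms, of e "\<not> k"] by simp
    moreover have "v \<notin> flip b ` e"
      using e mem_image_flip_iff[of b "flip b v" e] by simp
    ultimately show "e \<in> (\<lambda>e. flip b ` e) ` {e \<in> F_sys m k. v \<notin> e}"
      by (intro image_eqI[of _ _ "flip b ` e"]) (simp_all add: image_flip_image_flip)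
  qed
qed

text \<open>If p = b, both copies of \<open>b\<close> are missing; otherwise both are present.
  Either way exchanging them changes nothing.\<close>

lemma image_flip_G_block:
  assumes "b \<in> {1..m}" "cyc_add m p 1 \<noteq> b"
  shows "flip b ` G_block m p = G_block m p"
proof (intro set_eqI)
  fix v
  have "v \<in> flip b ` G_block m p \<longleftrightarrow> flip b v \<in> G_block m p"
    by (metis mem_image_flip_iff transpose_involutory)
  then show "v \<in> flip b ` G_block m p \<longleftrightarrow> v \<in> G_block m p"
    using assms by (cases v) (auto simp: transpose_def)
qed

lemma delete_vertex_M_sys_iso:
  assumes "m \<ge> 3" "v \<in> E_set m"
  shows "delete_vertex (E_set m, M_sys m k) v \<cong>\<^sub>h delete_vertex (E_set m, M_sys m (\<not> k)) v"
proof -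
  obtain q where q: "q \<in> {1..m}" "v = Inl q \<or> v = Inr q"
    using assms(2) by (auto simp: E_set_def)
  obtain b where b: "b \<in> {1..m}" "cyc_add m b 1 = q"
    using cyc_predecessor[of q m] assms(1) q(1) by auto
  have "b \<noteq> q" using b assms(1) by (auto simp: cyc_add_1 split: if_splits)
  then have flip_v: "flip b v = v" using q(2) by (auto simp: transpose_def)
  have "flip b ` e = e" if e: "e \<in> G_sys m" "v \<notin> e" for e
  proof -
    obtain p where p: "p \<in> {1..m}" "e = G_block m p"
      using e(1) by (auto simp: G_sys_def)
    then have "p = q \<or> cyc_add m p 1 = q" using e(2) q by auto
    \<comment> \<open>If p = q, the successor of \<open>q\<close> differs from its predecessor
      \<open>b\<close> because m \<ge> 3; otherwise the successor of \<open>p\<close> is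
      \<open>q\<close>, which is not \<open>b\<close>.\<close>
    then have "cyc_add m p 1 \<noteq> b"
      using b p(1) q(1) assms(1) by (auto simp: cyc_add_1 split: if_splits)
    with b(1) p(2) show ?thesis by (simp add: image_flip_G_block)
  qed
  then have "(\<lambda>e. flip b ` e) ` {e \<in> G_sys m. v \<notin> e} = (\<lambda>e. e) ` {e \<in> G_sys m. v \<notin> e}"
    by (intro image_cong) auto
  then have "(\<lambda>e. flip b ` e) ` {e \<in> M_sys m k. v \<notin> e} = {e \<in> M_sys m (\<not> k). v \<notin> e}"
    using image_flip_F_sys_avoiding[OF b(1), of k v]
    by (simp add: M_sys_def Collect_disj_eq conj_disj_distribR image_Un flip_v)
  moreover have "bij_betw (flip b) (E_set m - {v}) (E_set m - {v})"
    using b(1) q(2) \<open>b \<noteq> q\<close> by (intro bij_betw_transpose_iff) auto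
  ultimately show ?thesis
    unfolding hypergraph_iso_def delete_vertex_def by auto
qed

section \<open>Counting the blocks that avoid a vertex\<close>

lemma card_F_sys_avoiding_flip:
  assumes "b \<in> {1..m}"
  shows "card {e \<in> F_sys m (\<not> k). flip b v \<notin> e} = card {e \<in> F_sys m k. v \<notin> e}"
proof -
  have "inj_on (\<lambda>e. flip b ` e) A" for A
    by (rule inj_on_inverseI[of _ "\<lambda>e. flip b ` e"]) (simp add: image_flip_image_flip)
  then show ?thesis
    unfolding image_flip_F_sys_avoiding[OF assms, symmetric] by (rule card_image)
qed

lemma finite_F_sys: "finite (F_sys m k)"
  using finite_M_sys[of m k] by (simp add: M_sys_def)

lemma card_F_sys_avoiding_pair:
  assumes "a \<in> {1..m}"
  shows "card {e \<in> F_sys m k. Inl a \<notin> e} + card {e \<in> F_sys m k. Inr a \<notin> e} = card (F_sys m k)"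
proof -
  have "F_sys m k = {e \<in> F_sys m k. Inl a \<notin> e} \<union> {e \<in> F_sys m k. Inr a \<notin> e}"
    "{e \<in> F_sys m k. Inl a \<notin> e} \<inter> {e \<in> F_sys m k. Inr a \<notin> e} = {}"
    using F_sys_Inr_mem_iff assms by blast+
  then show ?thesis
    using finite_F_sys by (metis (lifting) card_Un_disjoint finite_Un)
qed

text \<open>Flipping an index other than \<open>a\<close> shows that the count for each copy of
  \<open>a\<close> is the same for both parities; flipping \<open>a\<close> itself equates the two
  copies. The pair identity then gives half the system. The right-hand side is fixed at
  \<open>True\<close>, so that it depends neither on \<open>v\<close> nor on
  \<open>k\<close>.\<close>

lemma card_F_sys_avoiding:
  assumes "m \<ge> 2" "v \<in> E_set m"
  shows "2 * card {e \<in> F_sys m k. v \<notin> e} = card (F_sys m True)"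
proof -
  obtain a where a: "a \<in> {1..m}" "v = Inl a \<or> v = Inr a"
    using assms(2) by (auto simp: E_set_def)
  \<comment> \<open>Any index other than \<open>a\<close> would do; one exists since m \<ge>
    2.\<close>
  define b where "b = (if a = 1 then 2 else 1 :: nat)"
  have b: "b \<in> {1..m}" "flip b (Inl a) = Inl a" "flip b (Inr a) = Inr a"
    using assms(1) by (auto simp: b_def transpose_def)
  define N where "N k v = card {e \<in> F_sys m k. v \<notin> e}" for k v
  have same: "N (\<not> k) (Inl a) = N k (Inl a)" "N (\<not> k) (Inr a) = N k (Inr a)" for k
    using card_F_sys_avoiding_flip[OF b(1), of k "Inl a"]
      card_F_sys_avoiding_flip[OF b(1), of k "Inr a"] by (simp_all add: N_def b(2,3))
  have swap: "N (\<not> k) (Inr a) = N k (Inl a)" for k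
    using card_F_sys_avoiding_flip[OF a(1), of k "Inl a"] by (simp add: N_def)
  have "N True (Inl a) + N True (Inr a) = card (F_sys m True)"
    using card_F_sys_avoiding_pair[OF a(1)] by (simp add: N_def)
  then have "2 * N k v = card (F_sys m True)"
    using a(2) same[of True] swap[of True] by (cases k) auto
  then show ?thesis by (simp add: N_def)
qed

lemma card_G_sys_avoiding_Inl:
  assumes "a \<in> {1..m}"
  shows "card {e \<in> G_sys m. Inl a \<notin> e} = 1"
proof -
  have "{e \<in> G_sys m. Inl a \<notin> e} = {G_block m a}"
    using assms by (auto simp: G_sys_def)
  then show ?thesis by simp
qed

lemma card_G_sys_avoiding_Inr:
  assumes "m \<ge> 2" "a \<in> {1..m}"
  shows "card {e \<in> G_sys m. Inr a \<notin> e} = 2"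
proof -
  obtain b where b: "b \<in> {1..m}" "cyc_add m b 1 = a"
    using cyc_predecessor assms by metis
  have "p = a \<or> p = b" if "p \<in> {1..m}" "Inr a \<notin> G_block m p" for p
    using that b assms by (auto simp: cyc_add_1 split: if_splits)
  moreover have "Inr a \<notin> G_block m a" "Inr a \<notin> G_block m b" using b(2) by auto
  ultimately have "{e \<in> G_sys m. Inr a \<notin> e} = {G_block m a, G_block m b}"
    unfolding G_sys_def using assms(2) b(1) by blast
  moreover have "b \<noteq> a" using b assms by (auto simp: cyc_add_1 split: if_splits)
  then have "G_block m a \<noteq> G_block m b"
    using G_block_subset_iff assms(2) b(1) by blast
  ultimately show ?thesis by simp
qed

lemma card_M_sys_avoiding:
  "card {e \<in> M_sys m k. v \<notin> e} = card {e \<in> F_sys m k. v \<notin> e} + card {e \<in> G_sys m. v \<notin> e}"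
proof -
  have "{e \<in> M_sys m k. v \<notin> e} = {e \<in> F_sys m k. v \<notin> e} \<union> {e \<in> G_sys m. v \<notin> e}"
    by (auto simp: M_sys_def)
  moreover have "{e \<in> F_sys m k. v \<notin> e} \<inter> {e \<in> G_sys m. v \<notin> e} = {}"
    using not_F_sys_subset_G_sys by blast
  ultimately show ?thesis
    using finite_M_sys[of m k] by (simp add: M_sys_def card_Un_disjoint)
qed

section \<open>Isomorphism invariants and nonisomorphism\<close>

lemma card_avoiding_iso:
  assumes f: "inj_on f A" "(\<lambda>e. f ` e) ` B = C" and "B \<subseteq> Pow A" "v \<in> A"
  shows "card {e \<in> C. f v \<notin> e} = card {e \<in> B. v \<notin> e}"
proof -
  have "f v \<in> f ` e \<longleftrightarrow> v \<in> e" if "e \<in> B" for e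
    using that assms inj_on_image_mem_iff by (metis PowD subsetD)
  then have "{e \<in> C. f v \<notin> e} = (\<lambda>e. f ` e) ` {e \<in> B. v \<notin> e}"
    using f(2) by auto
  moreover have "inj_on (\<lambda>e. f ` e) {e \<in> B. v \<notin> e}"
    using inj_on_image_Pow[OF f(1)] by (rule inj_on_subset) (use assms(3) in auto)
  ultimately show ?thesis by (simp add: card_image)
qed

text \<open>The number of blocks avoiding a vertex is invariant, and the share of
  \<open>F_sys\<close> cancels. What remains is the count in \<open>G_sys\<close>, which is 2 for
  primed and 1 for unprimed vertices.\<close>

lemma M_sys_iso_preserves_Inr:
  assumes "m \<ge> 2" "bij_betw f (E_set m) (E_set m)" "(\<lambda>e. f ` e) ` M_sys m k = M_sys m k'"
    "v \<in> E_set m"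
  shows "f v \<in> range Inr \<longleftrightarrow> v \<in> range Inr"
proof -
  have fv: "f v \<in> E_set m" using assms(2,4) bij_betwE by blast
  have "card {e \<in> M_sys m k'. f v \<notin> e} = card {e \<in> M_sys m k. v \<notin> e}"
    by (rule card_avoiding_iso[OF bij_betw_imp_inj_on[OF assms(2)] assms(3) M_sys_subset assms(4)])
  then have "card {e \<in> G_sys m. f v \<notin> e} = card {e \<in> G_sys m. v \<notin> e}"
    using card_F_sys_avoiding[OF assms(1) fv, of k'] card_F_sys_avoiding[OF assms(1,4), of k]
    by (simp add: card_M_sys_avoiding)
  moreover have "card {e \<in> G_sys m. w \<notin> e} = (if w \<in> range Inr then 2 else 1)"
    if "w \<in> E_set m" for w
    using that by (cases w) (auto simp: card_G_sys_avoiding_Inl card_G_sys_avoiding_Inr assms(1))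
  ultimately show ?thesis
    using fv assms(4) by (auto split: if_splits)
qed

text \<open>The set of primed vertices is the block of the empty set, whose size is even, and no
  other \<open>J\<close> yields it. Blocks of \<open>G_sys\<close> are excluded because they contain
  an unprimed vertex.\<close>

lemma primes_mem_M_sys_iff:
  assumes "m \<ge> 2"
  shows "Inr ` {1..m} \<in> M_sys m k \<longleftrightarrow> k"
proof
  have eq: "Inr ` {1..m} = F_block m {}" by (simp add: F_block_def)
  show "Inr ` {1..m} \<in> M_sys m k" if k
    using that unfolding eq M_sys_def F_sys_def by force
  assume "Inr ` {1..m} \<in> M_sys m k"
  moreover have "Inr ` {1..m} \<notin> G_sys m"
  proof
    assume "Inr ` {1..m} \<in> G_sys m"
    then obtain p where p: "Inr ` {1..m} = G_block m p" by (auto simp: G_sys_def)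
    define i where "i = (if p = 1 then 2 else 1 :: nat)"
    have "Inl i \<in> G_block m p" using assms by (auto simp: i_def)
    then show False unfolding p[symmetric] by auto
  qed
  ultimately obtain J where J: "Inr ` {1..m} = F_block m J" "even (card J) = k"
    by (auto simp: M_sys_def F_sys_def)
  have "J = {}" using J(1) F_block_mem(1)[of _ m J] by auto
  then show k using J(2) by simp
qed

lemma M_sys_not_iso:
  assumes "m \<ge> 2"
  shows "\<not> (E_set m, M_sys m False) \<cong>\<^sub>h (E_set m, M_sys m True)"
proof
  assume "(E_set m, M_sys m False) \<cong>\<^sub>h (E_set m, M_sys m True)"
  then obtain f where f: "bij_betw f (E_set m) (E_set m)"
    "(\<lambda>e. f ` e) ` M_sys m False = M_sys m True"
    by (auto simp: hypergraph_iso_def)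
  note preserves = M_sys_iso_preserves_Inr[OF assms f]
  have primes: "Inr ` {1..m} = E_set m \<inter> range Inr"
    by (auto simp: E_set_def)
  \<comment> \<open>The block mapped onto the set of primed vertices must, as \<open>f\<close>
    preserves that set, be the set itself, which the odd system lacks.\<close>
  obtain e where e: "e \<in> M_sys m False" "f ` e = E_set m \<inter> range Inr"
    using primes_mem_M_sys_iff[OF assms, of True] f(2) primes by (metis imageE)
  have "e \<subseteq> E_set m" using e(1) M_sys_subset by blast
  have "e = E_set m \<inter> range Inr"
  proof
    show "e \<subseteq> E_set m \<inter> range Inr"
      using \<open>e \<subseteq> E_set m\<close> e(2) preserves by blast
    show "E_set m \<inter> range Inr \<subseteq> e"
    proof
      fix v assume v: "v \<in> E_set m \<inter> range Inr"
      then have "f v \<in> f ` e"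
        using e(2) preserves[of v] bij_betwE[OF f(1)] by simp
      then show "v \<in> e"
        using inj_on_image_mem_iff[OF bij_betw_imp_inj_on[OF f(1)] _ \<open>e \<subseteq> E_set m\<close>] v by simp
    qed
  qed
  then show False
    using e(1) primes_mem_M_sys_iff[OF assms, of False] primes by simp
qed

theorem corollary7p3:
  fixes m :: nat
  assumes "m \<ge> 3"
  shows "sperner_system (E_set m) (M1 m) \<and> sperner_system (E_set m) (M2 m)
    \<and> \<not> (E_set m, M1 m) \<cong>\<^sub>h (E_set m, M2 m)
    \<and> strongly_hypomorphic (E_set m, M1 m) (E_set m, M2 m)"
  using sperner_M_sys[OF assms] M_sys_not_iso[of m] delete_vertex_M_sys_iso[OF assms, of _ False] assms
  by (simp add: M1_eq_M_sys M2_eq_M_sys strongly_hypomorphic_def)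

end
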